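(* Let $H=\mathbb C[S_3]$, where $S_3$ is generated by $u,v$ with $u^2=v^2=e$, $uvu=vuv$, with the bicovariant calculus given by $\mathcal C=\{u,v,uvu\}$, framed by the Maurer–Cartan form $\{E_a\}$. For the gamma-matrices $$\gamma_u=\frac13\begin{pmatrix}-1&1\\1&-1\end{pmatrix},\quad\gamma_v=\frac13\begin{pmatrix}0&0\\-1&-2\end{pmatrix},\quad\gamma_{uvu}=\frac13\begin{pmatrix}-2&-1\\0&0\end{pmatrix}$$ and the canonical Levi-Civita connection $A_a=E_a-\frac13\sum_bE_b$, the Dirac operator on $S_3$ is $$D\!\!\!\!/=\sum_a\partial^a\gamma_a-1=\frac13\begin{pmatrix}-\partial^u-2\partial^{uvu}-3&\partial^u-\partial^{uvu}\\\partial^u-\partial^v&-\partial^u-2\partial^v-3\end{pmatrix}.$$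
   Context: $\mathbb C[S_3]$ is the algebra of complex functions on $S_3$, $R_a(f)=f((\ )a)$, $\partial^a=R_a-\mathrm{id}$. $\Omega^1(H)$ is the free left $H$-module with basis $\{E_a\}_{a\in\mathcal C}$, with $E_af=R_a(f)E_a$ and $\mathrm df=\sum_a(\partial^af)E_a$. Spinors are functions on $S_3$ with values in $W=\mathbb C^2$, which carries the representation $$\rho_W(u)=\begin{pmatrix}0&1\\1&0\end{pmatrix},\qquad\rho_W(v)=\begin{pmatrix}1&0\\-1&-1\end{pmatrix}.$$ The gamma-matrices are the tautological ones $\gamma_a=\sum_b\eta^{-1}_{ab}\rho_W(b-e)=\frac13\rho_W(a-e)$ for the braided-Killing form $\eta^{ab}=3\delta^{ab}$. For a spin connection $\{A_b\}_{b\in\mathcal C}$ with components $A_b=\sum_aA_b{}^aE_a$, the Dirac operator is $$D\!\!\!\!/=\sum_a\partial^a\gamma_a-\sum_{a,b}A_b{}^a\gamma_a\tau_W^b,\qquad\tau_W^b=\rho_W(b^{-1}-e).$$ *)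

theory Defs
  imports "HOL-Analysis.Analysis" "HOL-Algebra.Sym_Groups" "HOL-Algebra.Generated_Groups"
begin

text \<open>
  Functions on a group \<open>G\<close> (scalar or spinor valued) are HOL functions on the underlying type;
  only their values on \<open>carrier G\<close> are meaningful, so equalities between them are to be stated
  pointwise on \<open>carrier G\<close>.
\<close>

definition rtrans :: "('g, 'm) monoid_scheme \<Rightarrow> 'g \<Rightarrow> ('g \<Rightarrow> 'b) \<Rightarrow> 'g \<Rightarrow> 'b" where
  "rtrans G a f = (\<lambda>x. f (x \<otimes>\<^bsub>G\<^esub> a))"

definition pdiff :: "('g, 'm) monoid_scheme \<Rightarrow> 'g \<Rightarrow> ('g \<Rightarrow> 'b::minus) \<Rightarrow> 'g \<Rightarrow> 'b" where
  "pdiff G a f = (\<lambda>x. rtrans G a f x - f x)"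

text \<open>
  A one-form is given by its coefficients in the basis \<open>{E_a}\<close>: \<open>\<omega> a\<close> is the coefficient function
  of \<open>E_a\<close> in \<open>\<omega>\<close>, meaningful for \<open>a\<close> in the index set \<open>\<C>\<close> of the calculus.
\<close>

type_synonym 'g form = "'g \<Rightarrow> 'g \<Rightarrow> complex"

definition mc_form :: "'g \<Rightarrow> 'g form" where
  "mc_form a = (\<lambda>b x. if b = a then 1 else 0)"

definition lmult :: "('g \<Rightarrow> complex) \<Rightarrow> 'g form \<Rightarrow> 'g form" where
  "lmult f \<omega> = (\<lambda>a x. f x * \<omega> a x)"

definition rmult :: "('g, 'm) monoid_scheme \<Rightarrow> 'g form \<Rightarrow> ('g \<Rightarrow> complex) \<Rightarrow> 'g form" where
  "rmult G \<omega> f = (\<lambda>a x. \<omega> a x * rtrans G a f x)"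

definition ext_d :: "('g, 'm) monoid_scheme \<Rightarrow> 'g set \<Rightarrow> ('g \<Rightarrow> complex) \<Rightarrow> 'g form" where
  "ext_d G C f = (\<lambda>b x. \<Sum>a\<in>C. lmult (pdiff G a f) (mc_form a) b x)"

lemma form_expansion:
  assumes "finite C" "b \<in> C"
  shows "\<omega> b x = (\<Sum>a\<in>C. lmult (\<omega> a) (mc_form a) b x)"
  using assms by (simp add: lmult_def mc_form_def if_distrib cong: if_cong)

lemma mc_form_commutation: "rmult G (mc_form a) f = lmult (rtrans G a f) (mc_form a)"
  by (auto simp: rmult_def lmult_def mc_form_def fun_eq_iff)

lemma ext_d_Leibniz:
  assumes "finite C" "b \<in> C"
  shows "ext_d G C (\<lambda>y. f y * g y) b x = rmult G (ext_d G C f) g b x + lmult f (ext_d G C g) b x"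
  using assms
  by (simp add: ext_d_def rmult_def lmult_def mc_form_def pdiff_def rtrans_def if_distrib
      algebra_simps cong: if_cong)

definition S3_calc :: "('g, 'm) monoid_scheme \<Rightarrow> 'g \<Rightarrow> 'g \<Rightarrow> 'g set" where
  "S3_calc G u v = {u, v, u \<otimes>\<^bsub>G\<^esub> v \<otimes>\<^bsub>G\<^esub> u}"

definition canonical_LC :: "'g set \<Rightarrow> 'g \<Rightarrow> 'g form" where
  "canonical_LC C a = (\<lambda>c x. mc_form a c x - (1/3) * (\<Sum>b\<in>C. mc_form b c x))"

definition mat2 :: "'b \<Rightarrow> 'b \<Rightarrow> 'b \<Rightarrow> 'b \<Rightarrow> 'b^2^2" where
  "mat2 a b c d = (\<chi> i j. if i = 1 then (if j = 1 then a else b) else (if j = 1 then c else d))"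

definition GL2 :: "(complex^2^2) monoid" where
  "GL2 = \<lparr>carrier = {M. invertible M}, mult = (**), one = mat 1\<rparr>"

definition killing :: "'g \<Rightarrow> 'g \<Rightarrow> real" where
  "killing a b = (if a = b then 3 else 0)"

text \<open>The inverse matrix over the index set \<open>C\<close>; its entries outside \<open>C\<close> are irrelevant.\<close>

definition killing_inv :: "'g set \<Rightarrow> 'g \<Rightarrow> 'g \<Rightarrow> real" where
  "killing_inv C = (SOME N. \<forall>a\<in>C. \<forall>c\<in>C. (\<Sum>b\<in>C. N a b * killing b c) = (if a = c then 1 else 0))"

lemma killing_inv_eq:
  assumes "finite C" "a \<in> C" "b \<in> C"
  shows "killing_inv C a b = (if a = b then 1/3 else 0)"
proof -
  let ?P = "\<lambda>N. \<forall>a\<in>C. \<forall>c\<in>C. (\<Sum>b\<in>C. N a b * killing b c) = (if a = c then 1 else 0::real)"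
  have red: "(\<Sum>b\<in>C. N a b * killing b c) = 3 * N a c" if "c \<in> C" for N :: "'a \<Rightarrow> 'a \<Rightarrow> real" and a c
    using that assms(1) by (simp add: killing_def if_distrib cong: if_cong)
  have "?P (\<lambda>a b. if a = b then 1/3 else 0)"
    using red[of _ "\<lambda>a b. if a = b then 1/3 else 0"] by simp
  then have "?P (killing_inv C)"
    unfolding killing_inv_def by (rule someI[where P="?P"])
  then show ?thesis
    using assms red[of b "killing_inv C" a] by (auto split: if_splits)
qed

definition gamma :: "('g, 'm) monoid_scheme \<Rightarrow> 'g set \<Rightarrow> ('g \<Rightarrow> complex^2^2) \<Rightarrow> 'g \<Rightarrow> complex^2^2" where
  "gamma G C \<rho> a = (\<Sum>b\<in>C. killing_inv C a b *\<^sub>R (\<rho> b - \<rho> \<one>\<^bsub>G\<^esub>))"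

definition tau :: "('g, 'm) monoid_scheme \<Rightarrow> ('g \<Rightarrow> complex^2^2) \<Rightarrow> 'g \<Rightarrow> complex^2^2" where
  "tau G \<rho> b = \<rho> (inv\<^bsub>G\<^esub> b) - \<rho> \<one>\<^bsub>G\<^esub>"

text \<open>\<open>A b\<close> is the one-form \<open>A_b\<close>, so \<open>A b a\<close> is its component along \<open>E_a\<close>.\<close>

definition dirac ::
  "('g, 'm) monoid_scheme \<Rightarrow> 'g set \<Rightarrow> ('g \<Rightarrow> complex^2^2) \<Rightarrow> ('g \<Rightarrow> 'g form) \<Rightarrow>
   ('g \<Rightarrow> complex^2) \<Rightarrow> 'g \<Rightarrow> complex^2" where
  "dirac G C \<rho> A \<psi> = (\<lambda>x.
     (\<Sum>a\<in>C. gamma G C \<rho> a *v pdiff G a \<psi> x)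
     - (\<Sum>a\<in>C. \<Sum>b\<in>C. A b a x *s ((gamma G C \<rho> a ** tau G \<rho> b) *v \<psi> x)))"

text \<open>Action on spinors of a matrix whose entries are operators on scalar functions.\<close>

definition op_mat_apply ::
  "((('g \<Rightarrow> complex) \<Rightarrow> 'g \<Rightarrow> complex)^2^2) \<Rightarrow> ('g \<Rightarrow> complex^2) \<Rightarrow> 'g \<Rightarrow> complex^2" where
  "op_mat_apply M \<psi> = (\<lambda>x. \<chi> i. \<Sum>j\<in>UNIV. (M $ i $ j) (\<lambda>y. \<psi> y $ j) x)"

end

theory Submission
  imports Defs
begin

text \<open>The relation \<open>u^2 = e\<close> and multiplicativity determine \<open>\<rho>\<close>
  on the identity and on \<open>w = uvu\<close>, so every gamma- and tau-matrix is an explicit 2x2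
  matrix. The gammas are \<open>1/3 (\<rho> a - 1)\<close> because the Killing form is 3 times the
  identity (\<open>gamma_eq\<close>). The components of the canonical connection are the constants
  \<open>\<delta> - 1/3\<close> (\<open>canonical_LC_eq\<close>), so its contribution is a fixed
  matrix, which turns out to be the identity; this is the \<open>- \<psi>\<close> in the Dirac
  operator. The matrix of operators then follows entry by entry, since partial derivatives act on
  each spinor component separately (\<open>pdiff_nth\<close>).\<close>

lemma mat2_nth [simp]:
  "mat2 a b c d $ 1 $ 1 = a" "mat2 a b c d $ 1 $ 2 = b"
  "mat2 a b c d $ 2 $ 1 = c" "mat2 a b c d $ 2 $ 2 = d"
  by (simp_all add: mat2_def)

lemma mat2_eq_iff: "M = mat2 a b c d \<longleftrightarrow> M $ 1 $ 1 = a \<and> M $ 1 $ 2 = b \<and> M $ 2 $ 1 = c \<and> M $ 2 $ 2 = d"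
  by (auto simp: vec_eq_iff forall_2)

lemma mat2_inject: "mat2 a b c d = mat2 a' b' c' d' \<longleftrightarrow> a = a' \<and> b = b' \<and> c = c' \<and> d = d'"
  by (simp add: mat2_eq_iff)

lemma mat2_mult:
  fixes a :: "'a::semiring_1"
  shows "mat2 a b c d ** mat2 a' b' c' d' =
    mat2 (a * a' + b * c') (a * b' + b * d') (c * a' + d * c') (c * b' + d * d')"
  by (simp add: mat2_eq_iff matrix_matrix_mult_def sum_2)

lemma mat2_diff: "mat2 a b c d - mat2 a' b' c' d' = mat2 (a - a') (b - b') (c - c') (d - d')"
  by (simp add: mat2_eq_iff)

lemma mat2_scaleR:
  fixes a :: "'a::real_algebra_1"
  shows "r *\<^sub>R mat2 a b c d = mat2 (of_real r * a) (of_real r * b) (of_real r * c) (of_real r * d)"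
  by (simp add: mat2_eq_iff flip: scaleR_conv_of_real)

lemma mat2_mult_vec_nth:
  fixes x :: "'a::semiring_1^2"
  shows "(mat2 a b c d *v x) $ 1 = a * x $ 1 + b * x $ 2"
    and "(mat2 a b c d *v x) $ 2 = c * x $ 1 + d * x $ 2"
  by (simp_all add: matrix_vector_mult_def sum_2)

lemma pdiff_nth: "pdiff G a \<psi> x $ i = pdiff G a (\<lambda>y. \<psi> y $ i) x"
  by (simp add: pdiff_def rtrans_def)

text \<open>The inverse Killing form is diagonal on \<open>C\<close>, so only the term
  \<open>b = a\<close> survives.\<close>

lemma gamma_eq:
  assumes "finite C" "a \<in> C"
  shows "gamma G C \<rho> a = (1/3) *\<^sub>R (\<rho> a - \<rho> \<one>\<^bsub>G\<^esub>)"
proof -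
  have "gamma G C \<rho> a = (\<Sum>b\<in>C. if b = a then (1/3) *\<^sub>R (\<rho> b - \<rho> \<one>\<^bsub>G\<^esub>) else 0)"
    unfolding gamma_def using assms by (intro sum.cong) (auto simp: killing_inv_eq)
  then show ?thesis
    using assms by simp
qed

text \<open>Along a direction \<open>c\<close> in \<open>C\<close>, the sum of all Maurer-Cartan
  forms has component 1, contributed by \<open>E_c\<close> alone.\<close>

lemma canonical_LC_eq:
  assumes "finite C" "c \<in> C"
  shows "canonical_LC C a c x = (if c = a then 2/3 else - (1/3))"
  using assms by (simp add: canonical_LC_def mc_form_def)

theorem proposition5p10:
  fixes u v :: "nat \<Rightarrow> nat" and \<rho> :: "(nat \<Rightarrow> nat) \<Rightarrow> complex^2^2"
  defines "G \<equiv> sym_group 3"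
  defines "w \<equiv> u \<otimes>\<^bsub>G\<^esub> v \<otimes>\<^bsub>G\<^esub> u"
  defines "C \<equiv> S3_calc G u v"
  assumes "u \<in> carrier G" and "v \<in> carrier G"
    and "generate G {u, v} = carrier G"
    and "u \<otimes>\<^bsub>G\<^esub> u = \<one>\<^bsub>G\<^esub>" and "v \<otimes>\<^bsub>G\<^esub> v = \<one>\<^bsub>G\<^esub>"
    and "u \<otimes>\<^bsub>G\<^esub> v \<otimes>\<^bsub>G\<^esub> u = v \<otimes>\<^bsub>G\<^esub> u \<otimes>\<^bsub>G\<^esub> v"
    and "\<rho> \<in> hom G GL2"
    and "\<rho> u = mat2 0 1 1 0" and "\<rho> v = mat2 1 0 (-1) (-1)"
  shows "gamma G C \<rho> u = (1/3) *\<^sub>R mat2 (-1) 1 1 (-1)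
    \<and> gamma G C \<rho> v = (1/3) *\<^sub>R mat2 0 0 (-1) (-2)
    \<and> gamma G C \<rho> w = (1/3) *\<^sub>R mat2 (-2) (-1) 0 0
    \<and> (\<forall>\<psi>. \<forall>x\<in>carrier G.
         dirac G C \<rho> (canonical_LC C) \<psi> x = (\<Sum>a\<in>C. gamma G C \<rho> a *v pdiff G a \<psi> x) - \<psi> x
       \<and> dirac G C \<rho> (canonical_LC C) \<psi> x =
           op_mat_apply
             (mat2
               (\<lambda>f y. (1/3) * (- pdiff G u f y - 2 * pdiff G w f y - 3 * f y))
               (\<lambda>f y. (1/3) * (pdiff G u f y - pdiff G w f y))
               (\<lambda>f y. (1/3) * (pdiff G u f y - pdiff G v f y))
               (\<lambda>f y. (1/3) * (- pdiff G u f y - 2 * pdiff G v f y - 3 * f y)))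
             \<psi> x)"
proof -
  interpret G: group G
    unfolding G_def by (rule sym_group_is_group)
  note [simp] = assms(4,5)
  have uu: "u \<otimes>\<^bsub>G\<^esub> u = \<one>\<^bsub>G\<^esub>" and vv: "v \<otimes>\<^bsub>G\<^esub> v = \<one>\<^bsub>G\<^esub>"
    and \<rho>u: "\<rho> u = mat2 0 1 1 0" and \<rho>v: "\<rho> v = mat2 1 0 (-1) (-1)"
    using assms by blast+
  have \<rho>_mult: "\<rho> (x \<otimes>\<^bsub>G\<^esub> y) = \<rho> x ** \<rho> y" if "x \<in> carrier G" "y \<in> carrier G" for x y
    using hom_mult[OF assms(10) that] by (simp add: GL2_def)
  \<comment> \<open>The value at the identity is read off as the square of the swap matrix
    \<open>\<rho> u\<close>.\<close>
  have \<rho>1: "\<rho> \<one>\<^bsub>G\<^esub> = mat2 1 0 0 1"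
    using \<rho>_mult[of u u] by (simp add: uu \<rho>u mat2_mult)
  have \<rho>w: "\<rho> w = mat2 (-1) (-1) 0 1"
    by (simp add: w_def \<rho>_mult \<rho>u \<rho>v mat2_mult)
  have inv_uv: "inv\<^bsub>G\<^esub> u = u" "inv\<^bsub>G\<^esub> v = v"
    by (simp_all add: uu vv G.inv_equality)
  \<comment> \<open>\<open>w\<close> is the conjugate of the involution \<open>v\<close> by
    \<open>u\<close>, hence an involution too.\<close>
  then have inv: "inv\<^bsub>G\<^esub> u = u" "inv\<^bsub>G\<^esub> v = v" "inv\<^bsub>G\<^esub> w = w"
    by (simp_all add: w_def G.inv_mult_group G.m_assoc)
  \<comment> \<open>Their images under \<open>\<rho>\<close> differ. This makes sums over the set
    \<open>C\<close> have three separate terms and decides the Kronecker deltas of the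
    connection.\<close>
  have distinct: "u \<noteq> v" "u \<noteq> w" "v \<noteq> w"
    using \<rho>u \<rho>v \<rho>w by (auto simp: mat2_inject)
  have C: "C = {u, v, w}"
    by (simp add: C_def S3_calc_def w_def)
  have gamma: "gamma G C \<rho> u = (1/3) *\<^sub>R mat2 (-1) 1 1 (-1)"
    "gamma G C \<rho> v = (1/3) *\<^sub>R mat2 0 0 (-1) (-2)"
    "gamma G C \<rho> w = (1/3) *\<^sub>R mat2 (-2) (-1) 0 0"
    by (simp_all add: C gamma_eq \<rho>u \<rho>v \<rho>w \<rho>1 mat2_diff)
  have tau: "tau G \<rho> u = mat2 (-1) 1 1 (-1)"
    "tau G \<rho> v = mat2 0 0 (-1) (-2)"
    "tau G \<rho> w = mat2 (-2) (-1) 0 0"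
    by (simp_all add: tau_def inv \<rho>u \<rho>v \<rho>w \<rho>1 mat2_diff)
  have sum_C: "(\<Sum>a\<in>C. f a) = f u + f v + f w" for f :: "(nat \<Rightarrow> nat) \<Rightarrow> complex^2"
    using distinct by (simp add: C add.assoc)
  have LC: "canonical_LC C b a x = (if a = b then 2/3 else - (1/3))" if "a \<in> C" for a b x
    using that by (simp add: C canonical_LC_eq)
  have inC: "u \<in> C" "v \<in> C" "w \<in> C"
    by (simp_all add: C)
  text \<open>Since each \<open>a \<in> C\<close> is an involution and \<open>\<Sum>a\<in>C. \<rho> a\<close> vanishes, \<open>\<tau>_a = 3 \<gamma>_a\<close>,
    \<open>\<gamma>_a\<^sup>2 = - (2/3) \<gamma>_a\<close> and \<open>\<Sum>a\<in>C. \<gamma>_a = - 1\<close>, so the spin connection contributes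
    \<open>3 (\<Sum>a\<in>C. \<gamma>_a\<^sup>2) - (\<Sum>a\<in>C. \<gamma>_a)\<^sup>2 = 2 - 1 = 1\<close>.\<close>
  have connection_term:
    "(\<Sum>a\<in>C. \<Sum>b\<in>C. canonical_LC C b a x *s ((gamma G C \<rho> a ** tau G \<rho> b) *v \<psi> x)) = \<psi> x"
    for \<psi> x
    using distinct distinct[symmetric]
    by (simp add: sum_C LC inC gamma tau mat2_scaleR mat2_mult vec_eq_iff forall_2
        mat2_mult_vec_nth field_simps)
  have D: "dirac G C \<rho> (canonical_LC C) \<psi> x = (\<Sum>a\<in>C. gamma G C \<rho> a *v pdiff G a \<psi> x) - \<psi> x"
    for \<psi> x
    by (simp only: dirac_def connection_term)
  \<comment> \<open>The \<open>- 3 * f y\<close> on the diagonal is \<open>- \<psi>\<close> under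
    the common factor 1/3; the other terms are the entries of the three gammas.\<close>
  have "(\<Sum>a\<in>C. gamma G C \<rho> a *v pdiff G a \<psi> x) - \<psi> x =
           op_mat_apply
             (mat2
               (\<lambda>f y. (1/3) * (- pdiff G u f y - 2 * pdiff G w f y - 3 * f y))
               (\<lambda>f y. (1/3) * (pdiff G u f y - pdiff G w f y))
               (\<lambda>f y. (1/3) * (pdiff G u f y - pdiff G v f y))
               (\<lambda>f y. (1/3) * (- pdiff G u f y - 2 * pdiff G v f y - 3 * f y)))
             \<psi> x" for \<psi> x
    by (simp add: sum_C gamma mat2_scaleR vec_eq_iff forall_2 mat2_mult_vec_nth
        op_mat_apply_def sum_2 pdiff_nth field_simps)
  with D gamma show ?thesis
    by simp
qed

end
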